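(* Let $t\ge 2$ and $n\ge 6$ be integers. Let $\Gamma$ be a $t\mathcal{C}_3^-$-free unbalanced signed graph of order $n$ whose index is maximum among all $t\mathcal{C}_3^-$-free unbalanced signed graphs of order $n$. Then, up to switching isomorphism, $$\Gamma\cong\begin{cases}\Gamma_{n,t+1} & \text{if } 2\le t\le n-2,\\ \Gamma_{n,n} & \text{if } t\ge n-1.\end{cases}$$
   Context: A signed graph $\Gamma=(G,\sigma)$ consists of a finite simple graph $G$ (its underlying graph) and a signature $\sigma:E(G)\to\{-1,+1\}$; its order is $|V(G)|$. Its adjacency matrix $A(\Gamma)$ has $(i,j)$ entry $\sigma(v_iv_j)$ if $v_i\sim v_j$ in $G$ and $0$ otherwise. The index of $\Gamma$ is the largest eigenvalue $\lambda_1(A(\Gamma))$. A cycle of $\Gamma$ is positive if it contains an even number of negative edges, and negative (unbalanced) otherwise. $\Gamma$ is balanced if it has no negative cycle, and unbalanced otherwise. Switching with respect to $U\subset V(G)$ reverses the signs of all edges between $U$ and $V(G)\setminus U$. Two signed graphs are switching isomorphic if one can be obtained from a signed graph isomorphic to the other (isomorphism preserving edge signs) by finitely many switchings. For an integer $t\ge 1$, $\Gamma$ is $t\mathcal{C}_3^-$-free if it does not contain $t$ distinct unbalanced triangles (signed subgraphs with underlying graph $C_3$ that are negative cycles). The triangles are not required to be vertex-disjoint or edge-disjoint; so $t\mathcal{C}_3^-$-free means at most $t-1$ distinct unbalanced triangles. For $3\le t\le n$, $\Gamma_{n,t}$ is the signed graph of order $n$ obtained from the complete graph $K_{n-1}$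 on $\{v_1,\dots,v_{n-1}\}$ with all edges positive by adding a new vertex $u$ and joining $u$ to the $t-1$ vertices $v_1,\dots,v_{t-1}$, where $uv_1$ is the unique negative edge of $\Gamma_{n,t}$. *)

theory Defs
  imports "Jordan_Normal_Form.Spectral_Radius"
begin

record 'v sgraph =
  verts :: "'v set"
  edges :: "'v set set"
  signature :: "'v set \<Rightarrow> int"

text \<open>The signature is a total function; only its values on the edges carry meaning.\<close>

definition signed_graph :: "'v sgraph \<Rightarrow> bool" where
  "signed_graph G \<longleftrightarrow> finite (verts G) \<and> edges G \<subseteq> {e. e \<subseteq> verts G \<and> card e = 2}
     \<and> (\<forall>e \<in> edges G. signature G e \<in> {-1, 1})"

definition sg_order :: "'v sgraph \<Rightarrow> nat" where
  "sg_order G = card (verts G)"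

definition vertex_enum :: "'v sgraph \<Rightarrow> 'v list" where
  "vertex_enum G = (SOME vs. distinct vs \<and> set vs = verts G)"

definition adj_matrix :: "'v sgraph \<Rightarrow> real mat" where
  "adj_matrix G = mat (sg_order G) (sg_order G)
     (\<lambda>(i, j). let e = {vertex_enum G ! i, vertex_enum G ! j}
        in if e \<in> edges G then of_int (signature G e) else 0)"

text \<open>The adjacency matrix is real and symmetric, so its real spectrum is its whole spectrum
  and does not depend on the chosen enumeration. The index is meaningful for positive order.\<close>

definition sg_index :: "'v sgraph \<Rightarrow> real" where
  "sg_index G = Max (spectrum (adj_matrix G))"

text \<open>A cycle is given by a list of its vertices in cyclic order. As a subgraph it is determined
  by its set of edges, whereas different lists (rotations, reversals) may give the same subgraph.\<close>

definition cycle_edges :: "'v list \<Rightarrow> 'v set set" where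
  "cycle_edges vs = {{vs ! i, vs ! (Suc i mod length vs)} | i. i < length vs}"

definition is_cycle :: "'v sgraph \<Rightarrow> 'v list \<Rightarrow> bool" where
  "is_cycle G vs \<longleftrightarrow> length vs \<ge> 3 \<and> distinct vs \<and> set vs \<subseteq> verts G \<and> cycle_edges vs \<subseteq> edges G"

definition negative_cycle :: "'v sgraph \<Rightarrow> 'v list \<Rightarrow> bool" where
  "negative_cycle G vs \<longleftrightarrow> is_cycle G vs \<and> odd (card {e \<in> cycle_edges vs. signature G e = -1})"

definition unbalanced :: "'v sgraph \<Rightarrow> bool" where
  "unbalanced G \<longleftrightarrow> (\<exists>vs. negative_cycle G vs)"

definition unbalanced_triangles :: "'v sgraph \<Rightarrow> 'v set set set" where
  "unbalanced_triangles G = {cycle_edges vs | vs. negative_cycle G vs \<and> length vs = 3}"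

definition unbalanced_triangle_free :: "nat \<Rightarrow> 'v sgraph \<Rightarrow> bool" where
  "unbalanced_triangle_free t G \<longleftrightarrow> \<not> (\<exists>T \<subseteq> unbalanced_triangles G. finite T \<and> card T = t)"

definition switching :: "'v set \<Rightarrow> 'v sgraph \<Rightarrow> 'v sgraph" where
  "switching U G = G\<lparr>signature := \<lambda>e. if card (e \<inter> U) = 1 then - signature G e else signature G e\<rparr>"

definition switching_step :: "'v sgraph \<Rightarrow> 'v sgraph \<Rightarrow> bool" where
  "switching_step G H \<longleftrightarrow> (\<exists>U \<subseteq> verts G. H = switching U G)"

definition sg_isomorphic :: "'v sgraph \<Rightarrow> 'w sgraph \<Rightarrow> bool" where
  "sg_isomorphic G H \<longleftrightarrow> (\<exists>f. bij_betw f (verts G) (verts H)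
     \<and> edges H = (\<lambda>e. f ` e) ` edges G \<and> (\<forall>e \<in> edges G. signature H (f ` e) = signature G e))"

definition switching_isomorphic :: "'v sgraph \<Rightarrow> 'w sgraph \<Rightarrow> bool" where
  "switching_isomorphic G H \<longleftrightarrow> (\<exists>G'. sg_isomorphic G G' \<and> switching_step\<^sup>*\<^sup>* G' H)"

text \<open>The vertex \<open>v\<^sub>i\<close> is represented by \<open>i\<close> for \<open>1 \<le> i \<le> n - 1\<close>, and \<open>u\<close> by \<open>0\<close>.\<close>

definition Gamma_graph :: "nat \<Rightarrow> nat \<Rightarrow> nat sgraph" where
  "Gamma_graph n t = \<lparr>verts = {0..<n},
     edges = {{i, j} | i j. 1 \<le> i \<and> i < j \<and> j \<le> n - 1} \<union> {{0, i} | i. 1 \<le> i \<and> i \<le> t - 1},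
     signature = (\<lambda>e. if e = {0, 1} then -1 else 1)\<rparr>"

definition unbalanced_free_graphs :: "nat \<Rightarrow> nat \<Rightarrow> 'v sgraph set" where
  "unbalanced_free_graphs n t =
     {G. signed_graph G \<and> sg_order G = n \<and> unbalanced G \<and> unbalanced_triangle_free t G}"

text \<open>If the vertex type has at least \<open>n\<close> elements, then every signed graph of order \<open>n\<close> has an
  isomorphic copy on that type. Any \<open>\<Gamma>\<close> of order \<open>n\<close> lives on such a type, so its maximality
  over that type is maximality over all signed graphs of order \<open>n\<close>.\<close>

definition index_maximal :: "nat \<Rightarrow> nat \<Rightarrow> 'v sgraph \<Rightarrow> bool" where
  "index_maximal n t \<Gamma> \<longleftrightarrow> \<Gamma> \<in> unbalanced_free_graphs n t \<and>
     (\<forall>\<Delta> \<in> (unbalanced_free_graphs n t :: 'v sgraph set). sg_index \<Delta> \<le> sg_index \<Gamma>)"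

end

theory Submission
  imports Defs "HOL-Analysis.Function_Topology"
begin

text \<open>
  The index of \<open>\<Gamma>\<close> is the maximum of the Rayleigh quotient of its adjacency matrix, attained
  at an eigenvector \<open>x\<close>. Switching at the vertices with negative coordinate preserves all cycle
  signs and replaces \<open>x\<close> by its absolute value, so let \<open>x \<ge> 0\<close>. As the graph is unbalanced it still
  has a negative edge \<open>uv\<close>, and by symmetry \<open>x\<^sub>u \<le> x\<^sub>v\<close>.

  A vertex \<open>w\<close> joined positively to both \<open>u\<close> and \<open>v\<close> closes an unbalanced triangle, so there are at
  most \<open>k = min (t - 1) (n - 2)\<close> of them; let \<open>T\<close> consist of \<open>k\<close> vertices and contain them all. Every
  other \<open>w\<close> lacks a positive edge to \<open>u\<close> or to \<open>v\<close>, and the cheaper edge to miss is \<open>uw\<close>. Hence the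
  quadratic form at \<open>x\<close> is bounded by that of the pointed clique \<open>B\<close>: all pairs that avoid \<open>u\<close> are
  positive edges, \<open>u\<close> is joined positively to \<open>T\<close> and negatively to \<open>v\<close>. This \<open>B\<close> is a copy of
  \<open>\<Gamma>\<^sub>n\<^sub>,\<^sub>k\<^sub>+\<^sub>2\<close>, is unbalanced and has only \<open>k < t\<close> unbalanced triangles, so its index is at most that of
  \<open>\<Gamma>\<close>. The bound is therefore an equality, \<open>x\<close> is an eigenvector of \<open>B\<close> as well, and the eigenvector
  equations of \<open>B\<close> are explicit enough to conclude that the two graphs have the same edges and signs
  (\<open>pointed_clique_rayleigh_equality\<close>). The degenerate case there is \<open>x\<^sub>u = 0\<close>, which forces
  \<open>k = 1\<close>: the signs at \<open>u\<close> then do not enter the quadratic form, and they are found from the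
  eigenvector equation of \<open>\<Gamma>\<close> at \<open>u\<close>.

  Both cases of the theorem are the statement for \<open>\<Gamma>\<^sub>n\<^sub>,\<^sub>k\<^sub>+\<^sub>2\<close>, with \<open>k = t - 1\<close> or \<open>k = n - 2\<close>.
\<close>

section \<open>The Rayleigh principle for symmetric weights on a finite set\<close>

definition quad_form :: "'v set \<Rightarrow> ('v \<Rightarrow> 'v \<Rightarrow> real) \<Rightarrow> ('v \<Rightarrow> real) \<Rightarrow> real" where
  "quad_form V a x = (\<Sum>i\<in>V. \<Sum>j\<in>V. a i j * x i * x j)"

lemma quad_form_eigen:
  assumes "\<forall>i\<in>V. (\<Sum>j\<in>V. a i j * x j) = m * x i"
  shows "quad_form V a x = m * (\<Sum>i\<in>V. (x i)\<^sup>2)"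
proof -
  have "quad_form V a x = (\<Sum>i\<in>V. x i * (\<Sum>j\<in>V. a i j * x j))"
    unfolding quad_form_def by (simp add: sum_distrib_left mult_ac)
  also have "\<dots> = (\<Sum>i\<in>V. m * (x i)\<^sup>2)"
    by (rule sum.cong) (use assms in \<open>auto simp: power2_eq_square\<close>)
  finally show ?thesis by (simp add: sum_distrib_left)
qed

lemma quad_form_scale: "quad_form V a (\<lambda>i. c * x i) = c\<^sup>2 * quad_form V a x"
  unfolding quad_form_def by (simp add: sum_distrib_left power2_eq_square mult_ac)

text \<open>The vertex type may be infinite, so the functions are pinned to \<open>0\<close> outside \<open>V\<close>; the sphere is
  then a closed subset of a product of compact intervals and points.\<close>

lemma compact_unit_sphere_functions:
  assumes "finite V"
  shows "compact {x :: 'v \<Rightarrow> real. (\<forall>i. i \<notin> V \<longrightarrow> x i = 0) \<and> (\<Sum>i\<in>V. (x i)\<^sup>2) = 1}" (is "compact ?S")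
proof -
  define K :: "'v \<Rightarrow> real set" where "K = (\<lambda>i. if i \<in> V then {-1..1} else {0})"
  have "compactin (product_topology (\<lambda>_. euclidean) UNIV) (PiE UNIV K)"
    by (subst compactin_PiE) (auto simp: K_def)
  hence K: "compact (PiE UNIV K)"
    by (simp add: euclidean_product_topology compactin_euclidean_iff)
  have "closed ((\<lambda>x :: 'v \<Rightarrow> real. \<Sum>i\<in>V. (x i)\<^sup>2) -` {1})"
    by (intro closed_vimage closed_singleton)
       (auto intro!: continuous_intros continuous_on_product_coordinates)
  hence "compact (PiE UNIV K \<inter> ((\<lambda>x. \<Sum>i\<in>V. (x i)\<^sup>2) -` {1}))"
    using K by (rule compact_Int_closed[rotated])
  moreover have "PiE UNIV K \<inter> ((\<lambda>x. \<Sum>i\<in>V. (x i)\<^sup>2) -` {1}) = ?S"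
  proof -
    have "\<bar>x i\<bar> \<le> 1" if "(\<Sum>i\<in>V. (x i)\<^sup>2) = 1" "i \<in> V" for x :: "'v \<Rightarrow> real" and i
    proof -
      have "(x i)\<^sup>2 \<le> 1"
        using member_le_sum[of i V "\<lambda>i. (x i)\<^sup>2"] that assms by auto
      thus ?thesis by (simp add: abs_square_le_1)
    qed
    hence "x i \<in> {-1..1}" if "(\<Sum>i\<in>V. (x i)\<^sup>2) = 1" "i \<in> V" for x :: "'v \<Rightarrow> real" and i
      using that by (simp add: abs_le_iff)
    hence "x \<in> PiE UNIV K" if "(\<forall>i. i \<notin> V \<longrightarrow> x i = 0)" "(\<Sum>i\<in>V. (x i)\<^sup>2) = 1" for x
      using that by (simp add: K_def PiE_iff)
    moreover have "x i = 0" if "x \<in> PiE UNIV K" "i \<notin> V" for x i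
      using PiE_mem[OF that(1), of i] that(2) by (simp add: K_def)
    ultimately show ?thesis by auto
  qed
  ultimately show ?thesis by simp
qed

lemma quad_form_attains_max:
  assumes "finite V" "V \<noteq> {}"
  obtains x where "(\<Sum>i\<in>V. (x i)\<^sup>2) = 1"
    and "\<And>y. quad_form V a y \<le> quad_form V a x * (\<Sum>i\<in>V. (y i)\<^sup>2)"
proof -
  let ?S = "{x :: 'a \<Rightarrow> real. (\<forall>i. i \<notin> V \<longrightarrow> x i = 0) \<and> (\<Sum>i\<in>V. (x i)\<^sup>2) = 1}"
  obtain v where v: "v \<in> V" using assms by auto
  define e :: "'a \<Rightarrow> real" where "e = (\<lambda>i. if i = v then 1 else 0)"
  have "(\<Sum>i\<in>V. (e i)\<^sup>2) = (\<Sum>i\<in>V. if i = v then 1 else 0)"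
    by (rule sum.cong) (auto simp: e_def)
  also have "\<dots> = 1" using v assms by simp
  finally have "e \<in> ?S" using v by (auto simp: e_def)
  hence ne: "?S \<noteq> {}" by blast
  have coord: "continuous_on ?S (\<lambda>x. x i)" for i
    by (rule continuous_on_subset[OF continuous_on_product_coordinates]) simp
  have cont: "continuous_on ?S (quad_form V a)"
    unfolding quad_form_def by (intro continuous_intros coord)
  obtain x where x: "x \<in> ?S" "\<forall>y\<in>?S. quad_form V a y \<le> quad_form V a x"
    using continuous_attains_sup[OF compact_unit_sphere_functions[OF assms(1)] ne cont] by blast
  show ?thesis
  proof (rule that[of x])
    show "(\<Sum>i\<in>V. (x i)\<^sup>2) = 1" using x by auto
    fix y :: "'a \<Rightarrow> real"
    define N where "N = (\<Sum>i\<in>V. (y i)\<^sup>2)"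
    show "quad_form V a y \<le> quad_form V a x * (\<Sum>i\<in>V. (y i)\<^sup>2)"
    proof (cases "N = 0")
      case True
      hence "\<forall>i\<in>V. y i = 0" unfolding N_def using assms(1) by (simp add: sum_nonneg_eq_0_iff)
      thus ?thesis unfolding quad_form_def by simp
    next
      case False
      moreover have "N \<ge> 0" unfolding N_def by (intro sum_nonneg) simp
      ultimately have N: "N > 0" by simp
      define z where "z = (\<lambda>i. if i \<in> V then (1 / sqrt N) * y i else 0)"
      have "(\<Sum>i\<in>V. (z i)\<^sup>2) = (\<Sum>i\<in>V. (1 / N) * (y i)\<^sup>2)"
        by (rule sum.cong) (use N in \<open>auto simp: z_def power_divide\<close>)
      also have "\<dots> = 1" using N unfolding N_def by (simp only: sum_distrib_left[symmetric]) simp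
      finally have "z \<in> ?S" by (auto simp: z_def)
      hence "quad_form V a z \<le> quad_form V a x" using x by blast
      moreover have "quad_form V a z = quad_form V a (\<lambda>i. (1 / sqrt N) * y i)"
        unfolding quad_form_def z_def by (intro sum.cong) auto
      ultimately have "(1 / N) * quad_form V a y \<le> quad_form V a x"
        using N by (simp only: quad_form_scale) (simp add: power_divide)
      thus ?thesis using N unfolding N_def[symmetric] by (simp add: field_simps)
    qed
  qed
qed

text \<open>First-order optimality: for each vertex \<open>k\<close>, the defect of the bound along
  \<open>x + s \<cdot> d\<close>, with \<open>d\<close> the indicator of \<open>k\<close>, is a quadratic polynomial in \<open>s\<close> without constant term
  and of constant sign, so its linear coefficient vanishes.\<close>

lemma quad_form_maximizer_eigen:
  assumes fin: "finite V" and sym: "\<And>i j. i \<in> V \<Longrightarrow> j \<in> V \<Longrightarrow> a i j = a j i"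
    and bound: "\<And>y. quad_form V a y \<le> m * (\<Sum>i\<in>V. (y i)\<^sup>2)"
    and att: "quad_form V a x = m * (\<Sum>i\<in>V. (x i)\<^sup>2)"
    and k: "k \<in> V"
  shows "(\<Sum>j\<in>V. a k j * x j) = m * x k"
proof -
  define d where "d = (\<lambda>i. if i = k then 1 else 0 :: real)"
  define L where "L = (\<Sum>j\<in>V. a k j * x j)"
  have exp: "quad_form V a (\<lambda>i. x i + s * d i) = quad_form V a x + 2 * s * L + s\<^sup>2 * a k k" for s
  proof -
    have "quad_form V a (\<lambda>i. x i + s * d i) = quad_form V a x
        + s * (\<Sum>i\<in>V. \<Sum>j\<in>V. a i j * d i * x j) + s * (\<Sum>i\<in>V. \<Sum>j\<in>V. a i j * x i * d j)
        + s\<^sup>2 * (\<Sum>i\<in>V. \<Sum>j\<in>V. a i j * d i * d j)"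
    proof -
      have "a i j * (x i + s * d i) * (x j + s * d j) = a i j * x i * x j
          + s * (a i j * d i * x j) + s * (a i j * x i * d j) + s\<^sup>2 * (a i j * d i * d j)" for i j
        by (simp add: algebra_simps power2_eq_square)
      thus ?thesis unfolding quad_form_def by (simp add: sum.distrib sum_distrib_left)
    qed
    moreover have "(\<Sum>i\<in>V. \<Sum>j\<in>V. a i j * d i * x j) = L"
    proof -
      have "(\<Sum>i\<in>V. \<Sum>j\<in>V. a i j * d i * x j) = (\<Sum>i\<in>V. if i = k then L else 0)"
        by (rule sum.cong) (auto simp: d_def L_def)
      thus ?thesis using fin k by simp
    qed
    moreover have "(\<Sum>i\<in>V. \<Sum>j\<in>V. a i j * x i * d j) = L"
    proof -
      have "(\<Sum>i\<in>V. \<Sum>j\<in>V. a i j * x i * d j) = (\<Sum>i\<in>V. a k i * x i)"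
        by (rule sum.cong) (use fin k sym in \<open>auto simp: d_def if_distrib cong: if_cong\<close>)
      thus ?thesis by (simp add: L_def)
    qed
    moreover have "(\<Sum>i\<in>V. \<Sum>j\<in>V. a i j * d i * d j) = a k k"
    proof -
      have "(\<Sum>i\<in>V. \<Sum>j\<in>V. a i j * d i * d j) = (\<Sum>i\<in>V. if i = k then a k k else 0)"
        by (rule sum.cong) (use fin k in \<open>auto simp: d_def if_distrib cong: if_cong\<close>)
      thus ?thesis using fin k by simp
    qed
    ultimately show ?thesis by simp
  qed
  have nrm: "(\<Sum>i\<in>V. (x i + s * d i)\<^sup>2) = (\<Sum>i\<in>V. (x i)\<^sup>2) + 2 * s * x k + s\<^sup>2" for s
  proof -
    have "(\<Sum>i\<in>V. (x i + s * d i)\<^sup>2) = (\<Sum>i\<in>V. (x i)\<^sup>2 + (if i = k then 2 * s * x k + s\<^sup>2 else 0))"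
      by (rule sum.cong) (auto simp: d_def power2_eq_square algebra_simps)
    thus ?thesis using fin k by (simp add: sum.distrib)
  qed
  define p q where "p = 2 * (L - m * x k)" and "q = a k k - m"
  have le: "s * p + s\<^sup>2 * q \<le> 0" for s
    using bound[of "\<lambda>i. x i + s * d i"] unfolding exp nrm att p_def q_def by (simp add: algebra_simps)
  have "p = 0"
  proof (rule ccontr)
    assume p: "p \<noteq> 0"
    \<comment> \<open>a step so small that the linear term outweighs the quadratic one\<close>
    define c where "c = \<bar>q\<bar> + 1"
    define s where "s = p / c"
    have c: "c > 0" "c + q > 0" unfolding c_def by linarith+
    hence "p = s * c" and "s \<noteq> 0" using p by (simp_all add: s_def)
    hence "s * p + s\<^sup>2 * q = s\<^sup>2 * (c + q)" by (simp add: power2_eq_square algebra_simps)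
    also have "\<dots> > 0" using \<open>s \<noteq> 0\<close> c by simp
    finally show False using le[of s] by linarith
  qed
  thus ?thesis unfolding p_def L_def by simp
qed

section \<open>The index as a Rayleigh maximum\<close>

definition edge_weight :: "'v sgraph \<Rightarrow> 'v \<Rightarrow> 'v \<Rightarrow> real" where
  "edge_weight G i j = (if {i, j} \<in> edges G then of_int (signature G {i, j}) else 0)"

lemma edge_weight_sym: "edge_weight G i j = edge_weight G j i"
  by (simp add: edge_weight_def insert_commute)

text \<open>A maximiser of the Rayleigh quotient is an eigenvector, so the maximum lies in the spectrum;
  conversely the quotient at an eigenvector is its eigenvalue. The vertex enumeration carries
  functions on the vertices to vectors and is not visible in the result.\<close>

lemma sg_index_is_rayleigh_max:
  assumes G: "signed_graph G" and ne: "verts G \<noteq> {}"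
  shows "quad_form (verts G) (edge_weight G) y \<le> sg_index G * (\<Sum>i\<in>verts G. (y i)\<^sup>2)"
    and "\<exists>x. (\<Sum>i\<in>verts G. (x i)\<^sup>2) = 1 \<and> (\<forall>i\<in>verts G. (\<Sum>j\<in>verts G. edge_weight G i j * x j) = sg_index G * x i)"
proof -
  let ?V = "verts G" and ?a = "edge_weight G" and ?A = "adj_matrix G"
  define n vs where "n = sg_order G" and "vs = vertex_enum G"
  have fin: "finite ?V" using G by (simp add: signed_graph_def)
  obtain us where "distinct us \<and> set us = ?V" using finite_distinct_list[OF fin] by blast
  hence "distinct vs \<and> set vs = ?V" unfolding vs_def vertex_enum_def by (rule someI)
  hence vs: "distinct vs" "set vs = ?V" by simp_all
  hence len: "length vs = n" using distinct_card[of vs] by (simp add: n_def sg_order_def)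
  have bij: "bij_betw (\<lambda>i. vs ! i) {0..<n} ?V"
    using bij_betw_nth[OF vs(1), of "{0..<n}" ?V] vs len by (auto simp: lessThan_atLeast0)
  have sum_vs: "(\<Sum>i\<in>{0..<n}. f (vs ! i)) = (\<Sum>i\<in>?V. f i)" for f :: "'a \<Rightarrow> real"
    by (rule sum.reindex_bij_betw[OF bij])
  have A: "?A = mat n n (\<lambda>(i, j). ?a (vs ! i) (vs ! j))"
    unfolding adj_matrix_def edge_weight_def n_def vs_def Let_def by simp
  have carr: "?A \<in> carrier_mat n n" by (simp add: A)
  have ev_iff: "?A *\<^sub>v vec n (\<lambda>i. x (vs ! i)) = k \<cdot>\<^sub>v vec n (\<lambda>i. x (vs ! i)) \<longleftrightarrow>
      (\<forall>i\<in>?V. (\<Sum>j\<in>?V. ?a i j * x j) = k * x i)" for x k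
  proof -
    have "(\<forall>i<n. (?A *\<^sub>v vec n (\<lambda>i. x (vs ! i))) $ i = (k \<cdot>\<^sub>v vec n (\<lambda>i. x (vs ! i))) $ i)
      \<longleftrightarrow> (\<forall>i<n. (\<Sum>j\<in>?V. ?a (vs ! i) j * x j) = k * x (vs ! i))"
      by (simp add: A scalar_prod_def sum_vs[symmetric])
    also have "\<dots> \<longleftrightarrow> (\<forall>i\<in>?V. (\<Sum>j\<in>?V. ?a i j * x j) = k * x i)"
      unfolding vs(2)[symmetric] all_set_conv_all_nth len ..
    finally show ?thesis using carr by (auto simp: vec_eq_iff)
  qed
  obtain x where x: "(\<Sum>i\<in>?V. (x i)\<^sup>2) = 1"
    and max: "\<And>y. quad_form ?V ?a y \<le> quad_form ?V ?a x * (\<Sum>i\<in>?V. (y i)\<^sup>2)"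
    using quad_form_attains_max[OF fin ne, of ?a] by blast
  define m where "m = quad_form ?V ?a x"
  have eig: "\<forall>i\<in>?V. (\<Sum>j\<in>?V. ?a i j * x j) = m * x i"
    by (intro ballI quad_form_maximizer_eigen[OF fin]) (use max x in \<open>auto simp: m_def edge_weight_sym\<close>)
  have "m \<in> spectrum ?A"
  proof -
    have "vec n (\<lambda>i. x (vs ! i)) \<noteq> 0\<^sub>v n"
    proof
      assume "vec n (\<lambda>i. x (vs ! i)) = 0\<^sub>v n"
      hence "\<forall>i<n. x (vs ! i) = 0" by (auto simp: vec_eq_iff)
      hence "(\<Sum>i\<in>{0..<n}. (x (vs ! i))\<^sup>2) = 0" by simp
      thus False using x sum_vs[of "\<lambda>v. (x v)\<^sup>2"] by simp
    qed
    moreover have "?A *\<^sub>v vec n (\<lambda>i. x (vs ! i)) = m \<cdot>\<^sub>v vec n (\<lambda>i. x (vs ! i))"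
      using eig ev_iff by blast
    ultimately have "eigenvector ?A (vec n (\<lambda>i. x (vs ! i))) m"
      using carr by (auto simp: eigenvector_def)
    thus ?thesis by (auto simp: spectrum_def eigenvalue_def)
  qed
  moreover have "k \<le> m" if k: "k \<in> spectrum ?A" for k
  proof -
    obtain v where v: "v \<in> carrier_vec n" "v \<noteq> 0\<^sub>v n" "?A *\<^sub>v v = k \<cdot>\<^sub>v v"
      using k carr by (auto simp: spectrum_def eigenvalue_def eigenvector_def)
    define y where "y = (\<lambda>w. v $ (inv_into {0..<n} (\<lambda>i. vs ! i) w))"
    have y: "y (vs ! i) = v $ i" if "i < n" for i
      using that bij_betw_inv_into_left[OF bij, of i] by (simp add: y_def)
    have vy: "v = vec n (\<lambda>i. y (vs ! i))" using v(1) y by auto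
    have "\<forall>i\<in>?V. (\<Sum>j\<in>?V. ?a i j * y j) = k * y i"
      using v(3) unfolding vy ev_iff .
    hence "k * (\<Sum>i\<in>?V. (y i)\<^sup>2) \<le> m * (\<Sum>i\<in>?V. (y i)\<^sup>2)"
      using max[of y] quad_form_eigen[of ?V ?a y k] unfolding m_def by simp
    moreover have "(\<Sum>i\<in>?V. (y i)\<^sup>2) > 0"
    proof -
      obtain i where i: "i < n" "v $ i \<noteq> 0"
        using v(1,2) by (metis carrier_vecD eq_vecI index_zero_vec(1,2))
      have "vs ! i \<in> ?V" using vs(2) len i(1) by (metis nth_mem)
      hence "(\<Sum>i\<in>?V. (y i)\<^sup>2) \<ge> (y (vs ! i))\<^sup>2"
        using member_le_sum[of "vs ! i" ?V "\<lambda>i. (y i)\<^sup>2"] fin by simp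
      moreover have "(y (vs ! i))\<^sup>2 > 0" using i y by simp
      ultimately show ?thesis by linarith
    qed
    ultimately show "k \<le> m" by simp
  qed
  ultimately have "sg_index G = m"
    unfolding sg_index_def using card_finite_spectrum(1)[OF carr] by (intro Max_eqI) auto
  thus "quad_form ?V ?a y \<le> sg_index G * (\<Sum>i\<in>?V. (y i)\<^sup>2)"
    and "\<exists>x. (\<Sum>i\<in>?V. (x i)\<^sup>2) = 1 \<and> (\<forall>i\<in>?V. (\<Sum>j\<in>?V. ?a i j * x j) = sg_index G * x i)"
    using max x eig unfolding m_def by auto
qed

section \<open>Pointed cliques and the equality case\<close>

text \<open>The graph \<open>\<Gamma>\<^sub>n\<^sub>,\<^sub>k\<^sub>+\<^sub>2\<close> on an arbitrary vertex set of size \<open>n\<close>, where \<open>T\<close> has \<open>k\<close> elements: it can then be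
  compared with \<open>\<Gamma>\<close> on the same vertices.\<close>

definition pointed_clique :: "'v set \<Rightarrow> 'v \<Rightarrow> 'v \<Rightarrow> 'v set \<Rightarrow> 'v sgraph" where
  "pointed_clique V u v T = \<lparr>verts = V,
     edges = {{i, j} | i j. i \<in> V - {u} \<and> j \<in> V - {u} \<and> i \<noteq> j} \<union> {{u, w} | w. w \<in> insert v T},
     signature = (\<lambda>e. if e = {u, v} then -1 else 1)\<rparr>"

lemma pointed_clique_weight:
  assumes "u \<in> V" "v \<in> V" "u \<noteq> v" "T \<subseteq> V - {u, v}" "i \<in> V" "j \<in> V"
  shows "edge_weight (pointed_clique V u v T) i j =
    (if i = j then 0 else if {i, j} = {u, v} then -1
     else if i \<noteq> u \<and> j \<noteq> u then 1 else if i \<in> T \<or> j \<in> T then 1 else 0)"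
proof -
  have edge: "{i, j} \<in> edges (pointed_clique V u v T) \<longleftrightarrow>
      (i \<noteq> u \<and> j \<noteq> u \<and> i \<noteq> j) \<or> (i = u \<and> j \<in> insert v T) \<or> (j = u \<and> i \<in> insert v T)"
    unfolding pointed_clique_def using assms(5,6)
    by (simp add: doubleton_eq_iff) blast
  have sgn: "signature (pointed_clique V u v T) {i, j} = (if {i, j} = {u, v} then -1 else 1)"
    by (simp add: pointed_clique_def)
  have T: "u \<notin> T" "v \<notin> T" using assms(4) by auto
  show ?thesis
    unfolding edge_weight_def edge sgn doubleton_eq_iff using assms(3) T by (cases "i = u"; cases "j = u") auto
qed

text \<open>The core of the argument. Here \<open>a\<close> is the weight of the extremal graph after switching, and the
  assumption \<open>bound\<close> says that its index \<open>l\<close> is at least that of the pointed clique.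

  Put \<open>D = b - a\<close>, where \<open>b\<close> is the weight of the pointed clique. The difference of the
  quadratic forms at \<open>x\<close> splits into the terms of \<open>D\<close> for pairs inside \<open>W = V - {u, v}\<close> and, for each
  \<open>w \<in> W\<close>, the joint contribution \<open>g w * x w\<close> of the pairs \<open>uw\<close> and \<open>vw\<close>. All of these are
  nonnegative and, by \<open>bound\<close>, sum up to at most zero, so they vanish and \<open>x\<close> is an eigenvector of
  \<open>b\<close>. Its equations at \<open>v\<close> and \<open>w \<in> W\<close> show that \<open>(l + 1) (x\<^sub>w - x\<^sub>v)\<close> is \<open>x\<^sub>u\<close> or \<open>2 x\<^sub>u\<close>, whence
  \<open>x\<close> is positive on \<open>W\<close> and at \<open>v\<close>; those at \<open>u\<close> and \<open>v\<close> show that \<open>x\<^sub>u < x\<^sub>v\<close> as soon as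
  \<open>T \<noteq> W\<close>. If \<open>x\<^sub>u > 0\<close>, this strict inequality excludes that some \<open>w\<close> outside \<open>T\<close> is joined to
  \<open>u\<close> rather than to \<open>v\<close>.\<close>

lemma pointed_clique_rayleigh_equality:
  fixes x :: "'v \<Rightarrow> real"
  assumes fin: "finite V" and card: "card V \<ge> 4" and V: "u \<in> V" "v \<in> V" "u \<noteq> v"
    and T: "T \<subseteq> V - {u, v}" "T \<noteq> {}"
    and sym: "\<And>i j. a i j = a j i" and diag: "\<And>i. a i i = 0"
    and entries: "\<And>i j. a i j \<in> {-1, 0, 1}" and neg: "a u v = -1"
    and common: "{w \<in> V. a u w = 1 \<and> a v w = 1} \<subseteq> T"
    and nonneg: "\<And>i. i \<in> V \<Longrightarrow> x i \<ge> 0" and nz: "\<exists>i\<in>V. x i \<noteq> 0" and uv: "x u \<le> x v"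
    and eig: "\<forall>i\<in>V. (\<Sum>j\<in>V. a i j * x j) = l * x i"
    and bound: "\<And>y. quad_form V (edge_weight (pointed_clique V u v T)) y \<le> l * (\<Sum>i\<in>V. (y i)\<^sup>2)"
    and ij: "i \<in> V" "j \<in> V"
  shows "a i j = edge_weight (pointed_clique V u v T) i j"
proof -
  define b where "b = edge_weight (pointed_clique V u v T)"
  define W where "W = V - {u, v}"
  have finW: "finite W" and W: "u \<notin> W" "v \<notin> W" and VW: "V = insert u (insert v W)" and TW: "T \<subseteq> W"
    using fin V T by (auto simp: W_def)
  have finT: "finite T" using TW finW finite_subset by blast
  have sumV: "(\<Sum>i\<in>V. f i) = f u + f v + (\<Sum>i\<in>W. f i)" for f :: "'v \<Rightarrow> real"
    unfolding VW using finW W V(3) by simp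
  have bsym: "b i j = b j i" for i j by (simp add: b_def edge_weight_sym)
  have b: "b u u = 0" "b v v = 0" "b u v = -1" "b v u = -1"
    using pointed_clique_weight[OF V T(1)] V by (auto simp: b_def)
  have bW: "b i j = (if i = j then 0 else 1)" if "i \<in> W" "j \<in> W" for i j
    using pointed_clique_weight[OF V T(1), of i j] that W unfolding b_def VW by (auto simp: doubleton_eq_iff)
  have bv: "b v w = 1" "b w v = 1" if "w \<in> W" for w
    using pointed_clique_weight[OF V T(1), of v w] pointed_clique_weight[OF V T(1), of w v] that W V(3)
    unfolding b_def VW by (auto simp: doubleton_eq_iff)
  have bu: "b u w = (if w \<in> T then 1 else 0)" "b w u = (if w \<in> T then 1 else 0)" if "w \<in> W" for w
    using pointed_clique_weight[OF V T(1), of u w] pointed_clique_weight[OF V T(1), of w u] that W V(3) TW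
    unfolding b_def VW by (auto simp: doubleton_eq_iff)
  have a_le: "a i j \<le> 1" for i j using entries[of i j] by auto
  have xW: "x w \<ge> 0" if "w \<in> W" for w using that nonneg VW by auto
  have xu: "x u \<ge> 0" using V nonneg by auto

  define D where "D = (\<lambda>i j. b i j - a i j)"
  have DW: "D i j \<ge> 0" if "i \<in> W" "j \<in> W" for i j
    using that bW a_le[of i j] diag[of i] by (auto simp: D_def)
  \<comment> \<open>For \<open>w\<close> outside \<open>T\<close> one of the two terms may be negative; only their sum has a sign.\<close>
  define g where "g = (\<lambda>w. D u w * x u + D v w * x v)"
  have g_out: "g w = (x v - a v w * x v) - a u w * x u" if "w \<in> W" "w \<notin> T" for w
    using that bu bv by (simp add: g_def D_def algebra_simps)
  have g_nonneg: "g w \<ge> 0" if w: "w \<in> W" for w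
  proof (cases "w \<in> T")
    case True
    thus ?thesis using w bu bv a_le xu uv by (simp add: g_def D_def)
  next
    case False
    hence "\<not> (a u w = 1 \<and> a v w = 1)" using common w VW by blast
    thus ?thesis unfolding g_out[OF w False] using entries[of u w] entries[of v w] xu uv by auto
  qed
  have split: "quad_form V b x - quad_form V a x = (\<Sum>i\<in>W. \<Sum>j\<in>W. D i j * x i * x j) + 2 * (\<Sum>w\<in>W. g w * x w)"
  proof -
    have D0: "D u u = 0" "D v v = 0" "D u v = 0" "D v u = 0"
      using b diag neg sym[of v u] by (auto simp: D_def)
    have Ds: "D w z = D z w" for w z using sym bsym by (simp add: D_def)
    have "quad_form V b x - quad_form V a x = (\<Sum>i\<in>V. \<Sum>j\<in>V. D i j * x i * x j)"
      unfolding quad_form_def D_def by (simp add: sum_subtractf algebra_simps)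
    also have "\<dots> = (\<Sum>w\<in>W. D u w * x u * x w) + (\<Sum>w\<in>W. D v w * x v * x w)
       + (\<Sum>w\<in>W. D w u * x w * x u + D w v * x w * x v + (\<Sum>j\<in>W. D w j * x w * x j))"
      unfolding sumV by (simp add: D0)
    also have "\<dots> = (\<Sum>i\<in>W. \<Sum>j\<in>W. D i j * x i * x j) + 2 * (\<Sum>w\<in>W. g w * x w)"
      unfolding sum.distrib g_def by (simp add: Ds[of _ u] Ds[of _ v] sum_distrib_left sum.distrib algebra_simps)
    finally show ?thesis .
  qed
  have qa: "quad_form V a x = l * (\<Sum>i\<in>V. (x i)\<^sup>2)" using quad_form_eigen[OF eig] .
  have qb: "quad_form V b x \<le> l * (\<Sum>i\<in>V. (x i)\<^sup>2)" using bound unfolding b_def .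
  have n1: "(\<Sum>i\<in>W. \<Sum>j\<in>W. D i j * x i * x j) \<ge> 0"
    by (intro sum_nonneg mult_nonneg_nonneg DW xW)
  have n2: "(\<Sum>w\<in>W. g w * x w) \<ge> 0" by (intro sum_nonneg mult_nonneg_nonneg g_nonneg xW)
  have qb_eq: "quad_form V b x = l * (\<Sum>i\<in>V. (x i)\<^sup>2)" and z1: "(\<Sum>i\<in>W. \<Sum>j\<in>W. D i j * x i * x j) = 0"
    and z2: "(\<Sum>w\<in>W. g w * x w) = 0"
    using split qa qb n1 n2 by linarith+
  have z1': "D i j * x i * x j = 0" if "i \<in> W" "j \<in> W" for i j
  proof -
    have "(\<Sum>j\<in>W. D i j * x i * x j) = 0"
      using z1 that finW by (subst (asm) sum_nonneg_eq_0_iff) (auto intro!: sum_nonneg mult_nonneg_nonneg DW xW)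
    thus ?thesis
      using that finW by (subst (asm) sum_nonneg_eq_0_iff) (auto intro!: mult_nonneg_nonneg DW xW)
  qed
  have z2': "g w * x w = 0" if "w \<in> W" for w
    using z2 that finW by (subst (asm) sum_nonneg_eq_0_iff) (auto intro!: mult_nonneg_nonneg g_nonneg xW)

  have eigb: "(\<Sum>j\<in>V. b i j * x j) = l * x i" if "i \<in> V" for i
    by (rule quad_form_maximizer_eigen[OF fin _ _ qb_eq that]) (use bsym bound in \<open>auto simp: b_def\<close>)
  define S where "S = (\<Sum>w\<in>W. x w)"
  have eqv: "l * x v = S - x u" using eigb[OF V(2)] unfolding sumV S_def by (simp add: b bv cong: sum.cong)
  have sumT: "(\<Sum>w\<in>W. (if w \<in> T then 1 else 0) * f w) = (\<Sum>w\<in>T. f w)" for f :: "'v \<Rightarrow> real"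
    using TW finW by (simp add: if_distrib[of "\<lambda>c. c * _"] sum.If_cases Int_absorb1 Int_absorb2 cong: if_cong)
  have equ: "l * x u = (\<Sum>w\<in>T. x w) - x v"
    using eigb[OF V(1)] unfolding sumV by (simp add: b bu sumT cong: sum.cong)
  have eqw: "(l + 1) * (x w - x v) = (if w \<in> T then 2 else 1) * x u" if "w \<in> W" for w
  proof -
    have "(\<Sum>j\<in>W. b w j * x j) = (\<Sum>j\<in>W. x j - (if j = w then x w else 0))"
      by (rule sum.cong) (use bW that in auto)
    also have "\<dots> = S - x w" using finW that by (simp add: sum_subtractf S_def)
    finally have "l * x w = (if w \<in> T then x u else 0) + x v + (S - x w)"
      using eigb[of w] that VW unfolding sumV by (auto simp: bu bv split: if_splits)
    thus ?thesis using eqv by (auto simp: algebra_simps)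
  qed
  have l: "l \<ge> 2"
  proof -
    \<comment> \<open>The clique on \<open>V - {u}\<close> contributes \<open>card W\<close> to the Rayleigh quotient.\<close>
    define y :: "'v \<Rightarrow> real" where "y = (\<lambda>i. if i = u then 0 else 1)"
    have y: "y u = 0" "y v = 1" "\<And>w. w \<in> W \<Longrightarrow> y w = 1" using V(3) W by (auto simp: y_def)
    have row: "(\<Sum>j\<in>W. b i j) = real (card W) - 1" if "i \<in> W" for i
    proof -
      have "(\<Sum>j\<in>W. b i j) = (\<Sum>j\<in>W. 1 - (if j = i then 1 else 0))"
        by (rule sum.cong) (use bW that in auto)
      thus ?thesis using finW that by (simp add: sum_subtractf)
    qed
    have "quad_form V b y = card W * (1 + real (card W))"
      unfolding quad_form_def sumV by (simp add: y b bv row algebra_simps)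
    moreover have "(\<Sum>i\<in>V. (y i)\<^sup>2) = 1 + card W"
      unfolding sumV by (simp add: y)
    ultimately have "card W * (1 + real (card W)) \<le> l * (1 + real (card W))"
      using bound[of y] unfolding b_def[symmetric] by simp
    hence "card W \<le> l" by simp
    moreover have "card V = card W + 2" unfolding VW using finW W V(3) by simp
    ultimately show ?thesis using card by linarith
  qed
  have xv: "x v > 0"
  proof (rule ccontr)
    assume "\<not> x v > 0"
    hence 0: "x u = 0" "x v = 0" using xu uv by auto
    hence "x w = 0" if "w \<in> W" for w using eqw[OF that] l by auto
    thus False using nz 0 VW by auto
  qed
  have xw: "x w > 0" if "w \<in> W" for w
  proof -
    have "(l + 1) * (x w - x v) \<ge> 0" unfolding eqw[OF that] using xu by auto
    hence "x w - x v \<ge> 0" using l by (simp add: zero_le_mult_iff)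
    thus ?thesis using xv by linarith
  qed
  have aW: "a i j = b i j" if "i \<in> W" "j \<in> W" for i j
    using z1'[OF that] xw[OF that(1)] xw[OF that(2)] by (simp add: D_def)
  have g0: "g w = 0" if "w \<in> W" for w using z2'[OF that] xw[OF that] by auto
  have auv: "a u w = b u w \<and> a v w = b v w" if w: "w \<in> W" for w
  proof (cases "x u = 0")
    case False
    hence xu: "x u > 0" using xu by simp
    show ?thesis
    proof (cases "w \<in> T")
      case True
      have "D u w * x u \<ge> 0" "D v w * x v \<ge> 0"
        using True w bu bv a_le xu xv by (auto simp: D_def intro!: mult_nonneg_nonneg)
      hence "D u w * x u = 0" "D v w * x v = 0" using g0[OF w] unfolding g_def by linarith+
      thus ?thesis using xu xv by (simp add: D_def)
    next
      case out: False
      have "(l - 1) * (x v - x u) = S - (\<Sum>w\<in>T. x w)" using equ eqv by (simp add: algebra_simps)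
      also have "\<dots> = (\<Sum>w\<in>W - T. x w)" using sum_diff[OF finW TW, of x] by (simp add: S_def)
      also have "\<dots> > 0" using finW w out xw by (intro sum_pos) auto
      finally have lt: "x v > x u" using l by (simp add: zero_less_mult_iff)
      have "\<not> (a u w = 1 \<and> a v w = 1)" using common w out VW by blast
      thus ?thesis
        using g0[OF w] unfolding g_out[OF w out] using entries[of u w] entries[of v w] xu xv lt w out bu bv
        by auto
    qed
  next
    case True
    \<comment> \<open>Now \<open>x\<close> is constant off \<open>u\<close>, so the equation of \<open>b\<close> at \<open>u\<close> makes \<open>T\<close> a singleton, and the equation of
      \<open>a\<close> at \<open>u\<close> says that the signs at \<open>u\<close> cancel.\<close>
    have xw_eq: "x w = x v" if "w \<in> W" for w using eqw[OF that] True l by auto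
    have av: "a v w = 1" if "w \<in> W" for w
      using g0[OF that] True xv bv[OF that] unfolding g_def D_def by simp
    have "(\<Sum>w\<in>T. x w) = card T * x v" using xw_eq TW by (simp add: subset_iff)
    hence "card T * x v = 1 * x v" using equ True by simp
    hence "card T = 1" using xv by simp
    then obtain p where p: "T = {p}" by (rule card_1_singletonE)
    have pW: "p \<in> W" using p TW by auto
    have "(\<Sum>w\<in>W. a u w * x w) = x v"
      using bspec[OF eig V(1)] unfolding sumV by (simp add: True diag neg)
    moreover have "(\<Sum>w\<in>W. a u w * x w) = x v * (\<Sum>w\<in>W. a u w)"
      using xw_eq by (simp add: sum_distrib_left mult_ac)
    ultimately have "(\<Sum>w\<in>W. a u w) = 1" using xv by simp
    moreover have "(\<Sum>w\<in>W. b u w) = 1"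
      using sumT[of "\<lambda>_. 1"] by (simp add: bu p cong: sum.cong)
    ultimately have s0: "(\<Sum>w\<in>W. b u w - a u w) = 0" by (simp add: sum_subtractf)
    have nn: "b u w - a u w \<ge> 0" if "w \<in> W" for w
    proof -
      have "w \<in> T" if "a u w = 1" using common that av[OF \<open>w \<in> W\<close>] \<open>w \<in> W\<close> VW by blast
      thus ?thesis using bu[OF that] entries[of u w] by auto
    qed
    have "b u w - a u w = 0"
      using s0 w finW nn by (subst (asm) sum_nonneg_eq_0_iff) auto
    thus ?thesis using av[OF w] bv[OF w] by simp
  qed
  have rows: "a u k = b u k" "a v k = b v k" if "k \<in> V" for k
    using that auv b diag neg sym[of v u] unfolding VW by auto
  have "a i j = b i j"
  proof (cases "i \<in> W \<and> j \<in> W")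
    case False
    hence "i = u \<or> i = v \<or> j = u \<or> j = v" using ij VW by blast
    thus ?thesis using rows ij sym bsym by metis
  qed (use aW in blast)
  thus ?thesis by (simp add: b_def)
qed

section \<open>Cycle signs and switching\<close>

lemma signed_graph_edge:
  assumes "signed_graph G" "{i, j} \<in> edges G"
  shows "i \<in> verts G" "j \<in> verts G" "i \<noteq> j" "signature G {i, j} = 1 \<or> signature G {i, j} = -1"
  using assms by (auto simp: signed_graph_def)

lemma edge_weight_cases:
  assumes "signed_graph G"
  shows "edge_weight G i j \<in> {-1, 0, 1}" "edge_weight G i i = 0"
  using signed_graph_edge[OF assms, of i j] signed_graph_edge[OF assms, of i i] by (auto simp: edge_weight_def)

lemma edge_iff_edge_weight: "signed_graph G \<Longrightarrow> {i, j} \<in> edges G \<longleftrightarrow> edge_weight G i j \<noteq> 0"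
  using signed_graph_edge(4)[of G i j] by (auto simp: edge_weight_def)

lemma edge_obtain_ends:
  assumes "signed_graph G" "e \<in> edges G"
  obtains i j where "e = {i, j}" "i \<in> verts G" "j \<in> verts G"
proof -
  have "e \<subseteq> verts G" "card e = 2" using assms by (auto simp: signed_graph_def)
  thus ?thesis using that unfolding card_2_iff by blast
qed

lemma cycle_edges_conv_image:
  "cycle_edges vs = (\<lambda>i. {vs ! i, vs ! (Suc i mod length vs)}) ` {..<length vs}"
  by (auto simp: cycle_edges_def)

lemma cycle_edges_triangle: "cycle_edges [a, b, c] = {{a, b}, {b, c}, {c, a}}"
proof -
  have "{..<length [a, b, c]} = {0, 1, 2}" by auto
  thus ?thesis by (simp add: cycle_edges_conv_image)
qed

text \<open>Two distinct positions with the same edge would be successors of each other, so that the length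
  divides \<open>2\<close>.\<close>

lemma inj_on_cycle_edges:
  assumes "distinct vs" "length vs \<ge> 3"
  shows "inj_on (\<lambda>i. {vs ! i, vs ! (Suc i mod length vs)}) {..<length vs}"
proof (rule inj_onI, rule ccontr)
  let ?n = "length vs"
  fix i j
  assume i: "i \<in> {..<?n}" and j: "j \<in> {..<?n}" and ne: "i \<noteq> j"
    and eq: "{vs ! i, vs ! (Suc i mod ?n)} = {vs ! j, vs ! (Suc j mod ?n)}"
  have "?n > 0" using i by auto
  hence lt: "Suc i mod ?n < ?n" "Suc j mod ?n < ?n" by (rule mod_less_divisor)+
  have "vs ! i \<noteq> vs ! j" using assms i j ne by (simp add: nth_eq_iff_index_eq)
  hence "vs ! i = vs ! (Suc j mod ?n)" "vs ! j = vs ! (Suc i mod ?n)"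
    using eq by (auto simp: doubleton_eq_iff)
  hence "i = Suc j mod ?n" "j = Suc i mod ?n"
    using assms i j lt by (simp_all add: nth_eq_iff_index_eq)
  moreover have "Suc k mod ?n = (if Suc k = ?n then 0 else Suc k)" if "k < ?n" for k
    using that by auto
  ultimately show False using i j assms(2) by (auto split: if_splits)
qed

lemma prod_signs: "finite E \<Longrightarrow> \<forall>e\<in>E. s e \<in> {-1, 1 :: int} \<Longrightarrow> prod s E = (-1) ^ card {e \<in> E. s e = -1}"
proof (induction E rule: finite_induct)
  case (insert e E)
  have "{e' \<in> insert e E. s e' = -1} = (if s e = -1 then insert e {e' \<in> E. s e' = -1} else {e' \<in> E. s e' = -1})"
    by auto
  thus ?case using insert by auto
qed simp

text \<open>With a product over positions, rather than over the edge set, the effect of switching can be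
  computed by a cyclic shift of the index.\<close>

lemma negative_cycle_iff_prod:
  assumes "signed_graph G" "is_cycle G vs"
  shows "negative_cycle G vs \<longleftrightarrow> (\<Prod>i<length vs. signature G {vs ! i, vs ! (Suc i mod length vs)}) = -1"
proof -
  have "finite (cycle_edges vs)" by (simp add: cycle_edges_conv_image)
  moreover have "\<forall>e\<in>cycle_edges vs. signature G e \<in> {-1, 1}"
    using assms by (auto simp: signed_graph_def is_cycle_def)
  ultimately have p: "prod (signature G) (cycle_edges vs) = (-1) ^ card {e \<in> cycle_edges vs. signature G e = -1}"
    by (rule prod_signs)
  have "prod (signature G) (cycle_edges vs) = (\<Prod>i<length vs. signature G {vs ! i, vs ! (Suc i mod length vs)})"
    unfolding cycle_edges_conv_image
    using assms inj_on_cycle_edges[of vs] by (subst prod.reindex) (auto simp: is_cycle_def)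
  thus ?thesis using p assms(2) by (cases "even (card {e \<in> cycle_edges vs. signature G e = -1})")
    (auto simp: negative_cycle_def)
qed

lemma switching_simps [simp]:
  "verts (switching U G) = verts G" "edges (switching U G) = edges G" "sg_order (switching U G) = sg_order G"
  "is_cycle (switching U G) vs = is_cycle G vs"
  by (simp_all add: switching_def sg_order_def is_cycle_def)

lemma signed_graph_switching: "signed_graph G \<Longrightarrow> signed_graph (switching U G)"
  by (auto simp: signed_graph_def switching_def)

lemma card_pair_Int: "i \<noteq> j \<Longrightarrow> card ({i, j} \<inter> U) = 1 \<longleftrightarrow> (i \<in> U) \<noteq> (j \<in> U)"
  by (cases "i \<in> U"; cases "j \<in> U") auto

lemma signature_switching:
  assumes "i \<noteq> j"
  shows "signature (switching U G) {i, j} =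
    (if i \<in> U then -1 else 1) * (if j \<in> U then -1 else 1) * signature G {i, j}"
  using card_pair_Int[OF assms, of U] by (simp add: switching_def)

lemma edge_weight_switching:
  assumes "signed_graph G"
  shows "edge_weight (switching U G) i j =
    (if i \<in> U then -1 else 1) * (if j \<in> U then -1 else 1) * edge_weight G i j"
  using signed_graph_edge(3)[OF assms, of i j] by (simp add: edge_weight_def signature_switching)

text \<open>Each vertex of the cycle lies on two of its edges, so its switching sign enters the product
  squared.\<close>

lemma negative_cycle_switching:
  assumes "signed_graph G"
  shows "negative_cycle (switching U G) vs \<longleftrightarrow> negative_cycle G vs"
proof (cases "is_cycle G vs")
  case True
  define n where "n = length vs"
  define s :: "nat \<Rightarrow> int" where "s = (\<lambda>i. if vs ! i \<in> U then -1 else 1)"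
  have n: "n > 0" using True by (auto simp: is_cycle_def n_def)
  have "bij_betw (\<lambda>i. Suc i mod n) {..<n} {..<n}"
  proof -
    have "inj_on (\<lambda>i. Suc i mod n) {..<n}"
      by (rule inj_onI) (auto simp: mod_Suc split: if_splits)
    moreover have "(\<lambda>i. Suc i mod n) ` {..<n} \<subseteq> {..<n}" using n by auto
    ultimately show ?thesis by (simp add: bij_betw_def endo_inj_surj)
  qed
  hence shift: "(\<Prod>i<n. s (Suc i mod n)) = (\<Prod>i<n. s i)" by (rule prod.reindex_bij_betw)
  have "(\<Prod>i<n. signature (switching U G) {vs ! i, vs ! (Suc i mod n)})
      = (\<Prod>i<n. s i * s (Suc i mod n) * signature G {vs ! i, vs ! (Suc i mod n)})"
  proof (rule prod.cong)
    fix i assume "i \<in> {..<n}"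
    hence "{vs ! i, vs ! (Suc i mod n)} \<in> edges G"
      using True by (auto simp: is_cycle_def cycle_edges_conv_image n_def)
    hence "vs ! i \<noteq> vs ! (Suc i mod n)" by (rule signed_graph_edge(3)[OF assms])
    thus "signature (switching U G) {vs ! i, vs ! (Suc i mod n)}
      = s i * s (Suc i mod n) * signature G {vs ! i, vs ! (Suc i mod n)}"
      by (simp add: signature_switching s_def)
  qed simp
  also have "\<dots> = (\<Prod>i<n. s i) * (\<Prod>i<n. s i) * (\<Prod>i<n. signature G {vs ! i, vs ! (Suc i mod n)})"
    by (simp add: prod.distrib shift)
  also have "(\<Prod>i<n. s i) * (\<Prod>i<n. s i) = 1"
    unfolding prod.distrib[symmetric] by (rule prod.neutral) (simp add: s_def)
  finally show ?thesis
    using negative_cycle_iff_prod[OF assms True] negative_cycle_iff_prod[OF signed_graph_switching[OF assms], of U vs] True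
    unfolding n_def by simp
qed (simp add: negative_cycle_def)

lemma unbalanced_free_graphs_switching:
  assumes "G \<in> unbalanced_free_graphs n t"
  shows "switching U G \<in> unbalanced_free_graphs n t"
proof -
  have G: "signed_graph G" using assms by (simp add: unbalanced_free_graphs_def)
  have "negative_cycle (switching U G) = negative_cycle G"
    using negative_cycle_switching[OF G] by blast
  thus ?thesis
    using assms signed_graph_switching[OF G]
    by (simp add: unbalanced_free_graphs_def unbalanced_def unbalanced_triangle_free_def unbalanced_triangles_def)
qed

lemma switching_switching [simp]: "switching U (switching U G) = G"
  by (cases G) (auto simp: switching_def fun_eq_iff)

text \<open>In \<open>switching_isomorphic\<close> the isomorphism comes first and the switching second; as switching is an
  involution, switching before the isomorphism can be undone after it, at the image set.\<close>

lemma switching_isomorphicI: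
  fixes G :: "'v sgraph" and K :: "'w sgraph"
  assumes G: "signed_graph G" and U: "U \<subseteq> verts G" and iso: "sg_isomorphic (switching U G) K"
  shows "switching_isomorphic G K"
proof -
  obtain f where f: "bij_betw f (verts G) (verts K)" and e: "edges K = (\<lambda>e. f ` e) ` edges G"
    and s: "\<forall>e\<in>edges G. signature K (f ` e) = signature (switching U G) e"
    using iso by (auto simp: sg_isomorphic_def)
  have sub: "f ` U \<subseteq> verts K" using f U by (auto simp: bij_betw_def)
  have "signature (switching (f ` U) K) (f ` e) = signature G e" if "e \<in> edges G" for e
  proof -
    have ev: "e \<subseteq> verts G" using that G by (auto simp: signed_graph_def)
    have inj: "inj_on f (verts G)" using f by (simp add: bij_betw_def)
    have "f ` e \<inter> f ` U = f ` (e \<inter> U)" using inj ev U by (simp add: inj_on_image_Int)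
    moreover have "card (f ` (e \<inter> U)) = card (e \<inter> U)"
      by (rule card_image[OF inj_on_subset[OF inj]]) (use ev in auto)
    ultimately have "card (f ` e \<inter> f ` U) = card (e \<inter> U)" by simp
    thus ?thesis using bspec[OF s that] by (simp add: switching_def)
  qed
  hence "sg_isomorphic G (switching (f ` U) K)"
    unfolding sg_isomorphic_def using f e by auto
  moreover have "switching_step (switching (f ` U) K) K"
    unfolding switching_step_def using sub by (intro exI[of _ "f ` U"]) simp
  ultimately show ?thesis unfolding switching_isomorphic_def by blast
qed

section \<open>Unbalanced triangles through a negative edge\<close>

text \<open>Each common positive neighbour of the ends of a negative edge closes an unbalanced triangle, and
  different neighbours give different vertex sets.\<close>

lemma card_common_positive_le:
  assumes G: "signed_graph G" and free: "unbalanced_triangle_free t G" and neg: "edge_weight G u v = -1"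
  shows "card {w \<in> verts G. edge_weight G u w = 1 \<and> edge_weight G v w = 1} < t"
proof (rule ccontr)
  let ?C = "{w \<in> verts G. edge_weight G u w = 1 \<and> edge_weight G v w = 1}"
  let ?h = "\<lambda>w. cycle_edges [u, v, w]"
  assume "\<not> card ?C < t"
  then obtain D where D: "D \<subseteq> ?C" "card D = t" "finite D" using obtain_subset_with_card_n[of t ?C] by auto
  have uv: "{u, v} \<in> edges G" "signature G {u, v} = -1"
    using neg by (auto simp: edge_weight_def split: if_splits)
  note uvG = signed_graph_edge[OF G uv(1)]
  have "?h w \<in> unbalanced_triangles G" if "w \<in> D" for w
  proof -
    have w: "{u, w} \<in> edges G" "signature G {u, w} = 1" "{v, w} \<in> edges G" "signature G {v, w} = 1"
      using that D(1) by (auto simp: edge_weight_def split: if_splits)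
    have ne: "u \<noteq> w" "v \<noteq> w" "w \<in> verts G"
      using signed_graph_edge[OF G w(1)] signed_graph_edge[OF G w(3)] by auto
    have "{e \<in> ?h w. signature G e = -1} = {{u, v}}"
      using uv w unfolding cycle_edges_triangle by (auto simp: insert_commute)
    hence "negative_cycle G [u, v, w]"
      using uv w ne uvG by (simp add: negative_cycle_def is_cycle_def cycle_edges_triangle insert_commute)
    thus ?thesis unfolding unbalanced_triangles_def by force
  qed
  moreover have "inj_on ?h D"
  proof (rule inj_onI)
    fix w w' assume "w \<in> D" "w' \<in> D" "?h w = ?h w'"
    hence "\<Union> (?h w) = \<Union> (?h w')" by simp
    hence "{u, v, w} = {u, v, w'}" unfolding cycle_edges_triangle by auto
    moreover have "w \<noteq> u" "w \<noteq> v"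
      using \<open>w \<in> D\<close> D(1) edge_weight_cases(2)[OF G, of u] edge_weight_cases(2)[OF G, of v] by auto
    ultimately show "w = w'" by blast
  qed
  hence "card (?h ` D) = t" using D(2) by (simp add: card_image)
  moreover have "?h ` D \<subseteq> unbalanced_triangles G" using calculation(1) by auto
  moreover have "finite (?h ` D)" using D(3) by simp
  ultimately have "\<exists>X \<subseteq> unbalanced_triangles G. finite X \<and> card X = t" by (intro exI[of _ "?h ` D"]) simp
  thus False using free unfolding unbalanced_triangle_free_def by simp
qed

lemma unbalanced_imp_negative_edge:
  assumes "signed_graph G" "unbalanced G"
  obtains u v where "u \<in> verts G" "v \<in> verts G" "u \<noteq> v" "edge_weight G u v = -1"
proof -
  obtain vs where "negative_cycle G vs" using assms(2) by (auto simp: unbalanced_def)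
  hence c: "cycle_edges vs \<subseteq> edges G" and "odd (card {e \<in> cycle_edges vs. signature G e = -1})"
    by (auto simp: negative_cycle_def is_cycle_def)
  hence "{e \<in> cycle_edges vs. signature G e = -1} \<noteq> {}" by (metis card.empty even_zero)
  then obtain e where e: "e \<in> edges G" "signature G e = -1" using c by auto
  then obtain u v where "e = {u, v}" using assms(1) by (auto simp: signed_graph_def card_2_iff)
  thus ?thesis using that[of u v] e signed_graph_edge[OF assms(1), of u v] by (auto simp: edge_weight_def)
qed

lemma signed_graph_pointed_clique:
  assumes "finite V" "u \<in> V" "v \<in> V" "u \<noteq> v" "T \<subseteq> V - {u, v}"
  shows "signed_graph (pointed_clique V u v T)"
proof -
  have "e \<subseteq> V \<and> card e = 2" if "e \<in> edges (pointed_clique V u v T)" for e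
  proof -
    have "\<exists>i j. e = {i, j} \<and> i \<in> V \<and> j \<in> V \<and> i \<noteq> j"
      using that assms unfolding pointed_clique_def by auto blast+
    thus ?thesis by auto
  qed
  moreover have "signature (pointed_clique V u v T) e \<in> {-1, 1}" for e
    by (simp add: pointed_clique_def)
  moreover have "verts (pointed_clique V u v T) = V" by (simp add: pointed_clique_def)
  ultimately show ?thesis
    using assms(1) unfolding signed_graph_def by (intro conjI subsetI ballI CollectI) auto
qed

text \<open>Every unbalanced triangle contains the only negative edge \<open>uv\<close>, and its third vertex is a
  neighbour of \<open>u\<close> other than \<open>v\<close>, that is, an element of \<open>T\<close>.\<close>

lemma pointed_clique_admissible:
  assumes fin: "finite V" and V: "u \<in> V" "v \<in> V" "u \<noteq> v" and T: "T \<subseteq> V - {u, v}" "T \<noteq> {}" and t: "card T < t"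
  shows "pointed_clique V u v T \<in> unbalanced_free_graphs (card V) t"
proof -
  let ?G = "pointed_clique V u v T"
  have finT: "finite T" using T fin finite_subset by blast
  have G: "signed_graph ?G"
    using fin V T(1) by (rule signed_graph_pointed_clique)
  have sgn: "signature ?G e = -1 \<longleftrightarrow> e = {u, v}" for e by (simp add: pointed_clique_def)
  have nbr: "{u, w} \<in> edges ?G \<longleftrightarrow> w = v \<or> w \<in> T" for w
    using T V by (auto simp: pointed_clique_def doubleton_eq_iff)
  have clique: "{w, z} \<in> edges ?G" if "w \<in> V - {u}" "z \<in> V - {u}" "w \<noteq> z" for w z
    using that by (auto simp: pointed_clique_def)
  have "unbalanced ?G"
  proof -
    obtain w where w: "w \<in> T" using T by blast
    hence wV: "w \<in> V" "w \<noteq> u" "w \<noteq> v" using T by auto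
    have "{e \<in> cycle_edges [u, v, w]. signature ?G e = -1} = {{u, v}}"
      using wV V unfolding cycle_edges_triangle sgn by (auto simp: doubleton_eq_iff)
    moreover have "is_cycle ?G [u, v, w]"
      using wV V w nbr[of v] nbr[of w] clique[of v w]
      by (simp add: is_cycle_def cycle_edges_triangle insert_commute) (simp add: pointed_clique_def)
    ultimately show ?thesis unfolding unbalanced_def negative_cycle_def by (intro exI[of _ "[u, v, w]"]) simp
  qed
  moreover have sub: "unbalanced_triangles ?G \<subseteq> (\<lambda>w. cycle_edges [u, v, w]) ` T"
  proof
    fix C assume "C \<in> unbalanced_triangles ?G"
    then obtain vs where vs: "C = cycle_edges vs" "negative_cycle ?G vs" "length vs = 3"
      by (auto simp: unbalanced_triangles_def)
    then obtain a b c where abc: "vs = [a, b, c]"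
      by (auto simp: numeral_3_eq_3 length_Suc_conv)
    have C: "C = {{a, b}, {b, c}, {c, a}}" using vs abc by (simp add: cycle_edges_triangle)
    have dist: "a \<noteq> b" "b \<noteq> c" "c \<noteq> a" and CE: "C \<subseteq> edges ?G"
      using vs abc by (auto simp: negative_cycle_def is_cycle_def)
    have "{e \<in> C. signature ?G e = -1} \<noteq> {}"
      using vs by (metis negative_cycle_def card.empty even_zero)
    hence uv: "{u, v} \<in> C" unfolding sgn by blast
    have third: "\<exists>w. w \<noteq> v \<and> C = {{u, v}, {v, w}, {w, u}}"
      if "{u, v} = {p, q}" "C = {{p, q}, {q, r}, {r, p}}" "q \<noteq> r" "r \<noteq> p" for p q r
    proof -
      have "u = p \<and> v = q \<or> u = q \<and> v = p" using that(1) by (auto simp: doubleton_eq_iff)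
      hence "r \<noteq> v \<and> C = {{u, v}, {v, r}, {r, u}}"
        using that by (elim disjE conjE) (simp_all add: insert_commute)
      thus ?thesis by blast
    qed
    have rot: "C = {{b, c}, {c, a}, {a, b}}" "C = {{c, a}, {a, b}, {b, c}}"
      unfolding C by (simp_all add: insert_commute)
    consider "{u, v} = {a, b}" | "{u, v} = {b, c}" | "{u, v} = {c, a}" using uv unfolding C by blast
    hence "\<exists>w. w \<noteq> v \<and> C = {{u, v}, {v, w}, {w, u}}"
      by cases (use third C rot dist in blast)+
    then obtain w where w: "w \<noteq> v" "C = {{u, v}, {v, w}, {w, u}}" by blast
    hence "{u, w} \<in> edges ?G" using CE by (auto simp: insert_commute)
    hence "w \<in> T" using nbr w(1) by blast
    thus "C \<in> (\<lambda>w. cycle_edges [u, v, w]) ` T" using w(2) by (auto simp: cycle_edges_triangle)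
  qed
  moreover have "unbalanced_triangle_free t ?G"
  proof -
    have "card X < t" if "X \<subseteq> unbalanced_triangles ?G" for X
    proof -
      have "card X \<le> card ((\<lambda>w. cycle_edges [u, v, w]) ` T)"
        using that sub finT by (intro card_mono) auto
      also have "\<dots> \<le> card T" by (rule card_image_le[OF finT])
      finally show ?thesis using t by simp
    qed
    thus ?thesis unfolding unbalanced_triangle_free_def by blast
  qed
  ultimately show ?thesis
    using G by (simp add: unbalanced_free_graphs_def sg_order_def) (simp add: pointed_clique_def)
qed

section \<open>Isomorphism with the graphs \<open>\<Gamma>\<^sub>n\<^sub>,\<^sub>t\<close>\<close>

lemma Gamma_graph_eq_pointed_clique:
  assumes "n \<ge> 2"
  shows "Gamma_graph n (k + 2) = pointed_clique {0..<n} 0 1 {2..<k + 2}"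
proof -
  have "{{i, j} | i j. 1 \<le> i \<and> i < j \<and> j \<le> n - 1}
      = {{i, j} | i j. i \<in> {0..<n} - {0} \<and> j \<in> {0..<n} - {0} \<and> i \<noteq> j}" (is "?L = ?R")
  proof
    show "?L \<subseteq> ?R" using assms by fastforce
    show "?R \<subseteq> ?L"
    proof
      fix e assume "e \<in> ?R"
      then obtain i j where ij: "e = {i, j}" "1 \<le> i" "1 \<le> j" "i \<le> n - 1" "j \<le> n - 1" "i \<noteq> j" by fastforce
      show "e \<in> ?L"
      proof (cases "i < j")
        case True
        thus ?thesis using ij by blast
      next
        case False
        hence "e = {j, i}" "j < i" using ij by auto
        thus ?thesis using ij by blast
      qed
    qed
  qed
  moreover have "{{0, i} | i. 1 \<le> i \<and> i \<le> k + 2 - 1} = {{0, w} | w. w \<in> insert 1 {2..<k + 2}}"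
  proof -
    have "1 \<le> i \<and> i \<le> k + 2 - 1 \<longleftrightarrow> i \<in> insert 1 {2..<k + 2}" for i by auto
    thus ?thesis by simp
  qed
  ultimately show ?thesis unfolding Gamma_graph_def pointed_clique_def by simp
qed

lemma sg_isomorphicI:
  assumes G: "signed_graph G" and H: "signed_graph H" and f: "bij_betw f (verts G) (verts H)"
    and w: "\<And>i j. i \<in> verts G \<Longrightarrow> j \<in> verts G \<Longrightarrow> edge_weight H (f i) (f j) = edge_weight G i j"
  shows "sg_isomorphic G H"
proof -
  have edge: "{f i, f j} \<in> edges H \<longleftrightarrow> {i, j} \<in> edges G" if "i \<in> verts G" "j \<in> verts G" for i j
    using w[OF that] by (simp add: edge_iff_edge_weight[OF G] edge_iff_edge_weight[OF H])
  have "e \<in> (\<lambda>e. f ` e) ` edges G" if e: "e \<in> edges H" for e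
  proof -
    obtain i' j' where ij: "e = {i', j'}" "i' \<in> verts H" "j' \<in> verts H" by (rule edge_obtain_ends[OF H e])
    then obtain i j where "i' = f i" "j' = f j" "i \<in> verts G" "j \<in> verts G"
      using bij_betw_imp_surj_on[OF f] by blast
    hence "e = f ` {i, j}" "{i, j} \<in> edges G" using ij(1) edge[of i j] e by auto
    thus ?thesis by blast
  qed
  moreover have "f ` e \<in> edges H \<and> signature H (f ` e) = signature G e" if e: "e \<in> edges G" for e
  proof -
    obtain i j where ij: "e = {i, j}" "i \<in> verts G" "j \<in> verts G" by (rule edge_obtain_ends[OF G e])
    hence "{f i, f j} \<in> edges H" using edge e by simp
    thus ?thesis using w[of i j] ij e by (simp add: edge_weight_def)
  qed
  ultimately show ?thesis unfolding sg_isomorphic_def using f by blast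
qed

text \<open>The isomorphism is glued from bijections of the parts \<open>{u}\<close>, \<open>{v}\<close>, \<open>T\<close> and the rest.\<close>

lemma isomorphic_to_pointed_clique:
  fixes G :: "'v sgraph" and V' :: "'w set"
  assumes G: "signed_graph G" and V: "u \<in> verts G" "v \<in> verts G" "u \<noteq> v" and T: "T \<subseteq> verts G - {u, v}"
    and w: "\<And>i j. i \<in> verts G \<Longrightarrow> j \<in> verts G \<Longrightarrow> edge_weight G i j = edge_weight (pointed_clique (verts G) u v T) i j"
    and V': "u' \<in> V'" "v' \<in> V'" "u' \<noteq> v'" and T': "T' \<subseteq> V' - {u', v'}"
    and card: "finite V'" "card V' = card (verts G)" "card T' = card T"
  shows "sg_isomorphic G (pointed_clique V' u' v' T')"
proof -
  let ?V = "verts G"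
  define R where "R = ?V - {u, v} - T"
  define R' where "R' = V' - {u', v'} - T'"
  have fin: "finite ?V" using G by (simp add: signed_graph_def)
  have fT: "finite T" "finite T'" using T T' fin card(1) finite_subset by blast+
  have "card R = card ?V - 2 - card T"
    unfolding R_def using fin V T fT by (simp add: card_Diff_subset)
  moreover have "card R' = card V' - 2 - card T'"
    unfolding R'_def using card(1) V' T' fT by (simp add: card_Diff_subset)
  ultimately have cR: "card R = card R'" using card by simp
  obtain g where g: "bij_betw g T T'" using finite_same_card_bij[OF fT] card(3) by auto
  obtain h where h: "bij_betw h R R'"
    using finite_same_card_bij[of R R'] cR fin card(1) by (auto simp: R_def R'_def)
  define f where "f = (\<lambda>x. if x = u then u' else if x = v then v' else if x \<in> T then g x else h x)"
  have notin: "u \<notin> T" "v \<notin> T" "u \<notin> R" "v \<notin> R" "T \<inter> R = {}" using T by (auto simp: R_def)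
  have notin': "u' \<notin> T'" "v' \<notin> T'" "u' \<notin> R'" "v' \<notin> R'" "T' \<inter> R' = {}" using T' by (auto simp: R'_def)
  have fu: "f u = u'" "f v = v'" using V by (auto simp: f_def)
  have bT: "bij_betw f T T'" using g by (rule bij_betw_cong[THEN iffD1, rotated]) (use notin in \<open>auto simp: f_def\<close>)
  have bR: "bij_betw f R R'" using h by (rule bij_betw_cong[THEN iffD1, rotated]) (use notin in \<open>auto simp: f_def\<close>)
  have buv: "bij_betw f {u, v} {u', v'}" using fu V V' by (auto simp: bij_betw_def)
  have "bij_betw f ({u, v} \<union> (T \<union> R)) ({u', v'} \<union> (T' \<union> R'))"
    by (intro bij_betw_combine buv bT bR) (use notin' in auto)
  moreover have "{u, v} \<union> (T \<union> R) = ?V" "{u', v'} \<union> (T' \<union> R') = V'"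
    using V T V' T' by (auto simp: R_def R'_def)
  ultimately have bij: "bij_betw f ?V V'" by simp
  hence inj: "f i = f j \<longleftrightarrow> i = j" if "i \<in> ?V" "j \<in> ?V" for i j
    using that by (auto simp: bij_betw_def inj_on_def)
  have fT_iff: "f i \<in> T' \<longleftrightarrow> i \<in> T" if "i \<in> ?V" for i
  proof -
    have "T' = f ` T" using bT by (simp add: bij_betw_def)
    thus ?thesis using inj that T by (auto simp: subset_iff)
  qed
  have fV: "f i \<in> V'" if "i \<in> ?V" for i using bij that by (auto simp: bij_betw_def)
  have G': "signed_graph (pointed_clique V' u' v' T')"
    using card(1) V' T' by (rule signed_graph_pointed_clique)
  show ?thesis
  proof (rule sg_isomorphicI[OF G G'])
    show "bij_betw f ?V (verts (pointed_clique V' u' v' T'))" using bij by (simp add: pointed_clique_def)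
    fix i j assume ij: "i \<in> ?V" "j \<in> ?V"
    have "{f i, f j} = {u', v'} \<longleftrightarrow> {i, j} = {u, v}"
      unfolding doubleton_eq_iff fu[symmetric] using inj ij V by simp
    moreover have iu: "f i = u' \<longleftrightarrow> i = u" "f j = u' \<longleftrightarrow> j = u"
      unfolding fu(1)[symmetric] using inj ij V(1) by simp_all
    ultimately show "edge_weight (pointed_clique V' u' v' T') (f i) (f j) = edge_weight G i j"
      unfolding w[OF ij] pointed_clique_weight[OF V T ij] pointed_clique_weight[OF V' T' fV[OF ij(1)] fV[OF ij(2)]]
      by (simp only: \<open>{f i, f j} = {u', v'} \<longleftrightarrow> {i, j} = {u, v}\<close> inj[OF ij] iu fT_iff[OF ij(1)] fT_iff[OF ij(2)])
  qed
qed

section \<open>The extremal graph\<close>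

lemma index_maximal_imp_Gamma_graph:
  fixes \<Gamma> :: "'v sgraph"
  assumes t: "t \<ge> 2" and n: "n \<ge> 4" and max: "index_maximal n t \<Gamma>"
  shows "switching_isomorphic \<Gamma> (Gamma_graph n (min (t - 1) (n - 2) + 2))"
proof -
  let ?V = "verts \<Gamma>" and ?l = "sg_index \<Gamma>"
  define k where "k = min (t - 1) (n - 2)"
  have mem: "\<Gamma> \<in> unbalanced_free_graphs n t" using max by (simp add: index_maximal_def)
  have G: "signed_graph \<Gamma>" and cV: "card ?V = n"
    using mem by (auto simp: unbalanced_free_graphs_def sg_order_def)
  have fin: "finite ?V" using G by (simp add: signed_graph_def)
  have ne: "?V \<noteq> {}" using cV n by auto
  obtain x where x1: "(\<Sum>i\<in>?V. (x i)\<^sup>2) = 1"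
    and eig: "\<forall>i\<in>?V. (\<Sum>j\<in>?V. edge_weight \<Gamma> i j * x j) = ?l * x i"
    using sg_index_is_rayleigh_max(2)[OF G ne] by blast
  \<comment> \<open>Switch so that the eigenvector becomes nonnegative.\<close>
  define U where "U = {i \<in> ?V. x i < 0}"
  define H where "H = switching U \<Gamma>"
  define y where "y = (\<lambda>i. \<bar>x i\<bar>)"
  have Hmem: "H \<in> unbalanced_free_graphs n t"
    unfolding H_def by (rule unbalanced_free_graphs_switching[OF mem])
  have HV: "verts H = ?V" by (simp add: H_def)
  have H: "signed_graph H" "unbalanced H" "unbalanced_triangle_free t H"
    using Hmem by (auto simp: unbalanced_free_graphs_def)
  have eigH: "\<forall>i\<in>?V. (\<Sum>j\<in>?V. edge_weight H i j * y j) = ?l * y i"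
  proof
    fix i assume i: "i \<in> ?V"
    define s :: "'v \<Rightarrow> real" where "s = (\<lambda>i. if i \<in> U then -1 else 1)"
    have y: "y j = s j * x j" if "j \<in> ?V" for j using that by (auto simp: y_def s_def U_def)
    have "(\<Sum>j\<in>?V. edge_weight H i j * y j) = (\<Sum>j\<in>?V. s i * (edge_weight \<Gamma> i j * x j))"
      by (rule sum.cong) (auto simp: y H_def edge_weight_switching[OF G] s_def)
    also have "\<dots> = s i * (\<Sum>j\<in>?V. edge_weight \<Gamma> i j * x j)" by (simp add: sum_distrib_left)
    also have "\<dots> = ?l * y i" using eig i by (simp add: y)
    finally show "(\<Sum>j\<in>?V. edge_weight H i j * y j) = ?l * y i" .
  qed
  have nz: "\<exists>i\<in>?V. y i \<noteq> 0"
  proof (rule ccontr)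
    assume "\<not> ?thesis"
    hence "(\<Sum>i\<in>?V. (x i)\<^sup>2) = 0" by (simp add: y_def)
    thus False using x1 by simp
  qed
  obtain u v where uv: "u \<in> ?V" "v \<in> ?V" "u \<noteq> v" "edge_weight H u v = -1" "y u \<le> y v"
  proof -
    obtain a b where "a \<in> ?V" "b \<in> ?V" "a \<noteq> b" "edge_weight H a b = -1"
      using unbalanced_imp_negative_edge[OF H(1,2)] HV by metis
    thus ?thesis using that[of a b] that[of b a] edge_weight_sym[of H a b] by (cases "y a \<le> y b") auto
  qed
  define C where "C = {w \<in> ?V. edge_weight H u w = 1 \<and> edge_weight H v w = 1}"
  have Csub: "C \<subseteq> ?V - {u, v}"
    using edge_weight_cases(2)[OF H(1), of u] edge_weight_cases(2)[OF H(1), of v] by (auto simp: C_def)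
  have cW: "card (?V - {u, v}) = n - 2" using uv cV fin by (simp add: card_Diff_subset)
  have "card C < t" using card_common_positive_le[OF H(1,3) uv(4)] by (simp add: C_def HV)
  moreover have "card C \<le> n - 2" using card_mono[OF _ Csub] fin cW by simp
  ultimately have "card C \<le> k" by (simp add: k_def)
  moreover have "k \<le> card (?V - {u, v})" unfolding cW k_def by simp
  ultimately obtain T where T: "C \<subseteq> T" "T \<subseteq> ?V - {u, v}" "card T = k"
    using exists_subset_between[of C k "?V - {u, v}"] Csub fin by auto
  have "k \<ge> 1" "k < t" using t n by (auto simp: k_def)
  hence Tne: "T \<noteq> {}" and Tt: "card T < t" using T(3) by auto
  let ?B = "pointed_clique ?V u v T"
  have B: "?B \<in> unbalanced_free_graphs n t"
    using pointed_clique_admissible[OF fin uv(1-3) T(2) Tne Tt] cV by simp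
  have "sg_index ?B \<le> ?l" using max B by (auto simp: index_maximal_def)
  moreover have "verts ?B = ?V" by (simp add: pointed_clique_def)
  moreover have "signed_graph ?B" using B by (simp add: unbalanced_free_graphs_def)
  ultimately have bound: "quad_form ?V (edge_weight ?B) z \<le> ?l * (\<Sum>i\<in>?V. (z i)\<^sup>2)" for z
    using sg_index_is_rayleigh_max(1)[of ?B z] ne
    by (smt (verit, best) mult_right_mono sum_nonneg zero_le_power2)
  have "edge_weight H i j = edge_weight ?B i j" if "i \<in> ?V" "j \<in> ?V" for i j
  proof (rule pointed_clique_rayleigh_equality[where a = "edge_weight H" and x = y and l = ?l])
    show "card ?V \<ge> 4" using cV n by simp
    show "{w \<in> ?V. edge_weight H u w = 1 \<and> edge_weight H v w = 1} \<subseteq> T" using T(1) by (simp add: C_def)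
    show "y i \<ge> 0" for i by (simp add: y_def)
  qed (fact fin uv T(2) Tne nz eigH bound that edge_weight_sym edge_weight_cases[OF H(1)])+
  hence "sg_isomorphic H (pointed_clique {0..<n} 0 1 {2..<k + 2})"
  proof (intro isomorphic_to_pointed_clique[where u = u and v = v and T = T])
    show "{2..<k + 2} \<subseteq> {0..<n} - {0, 1}" using n by (auto simp: k_def)
  qed (use H(1) HV uv T n cV in auto)
  moreover have "Gamma_graph n (k + 2) = pointed_clique {0..<n} 0 1 {2..<k + 2}"
    using n by (intro Gamma_graph_eq_pointed_clique) simp
  ultimately have "sg_isomorphic (switching U \<Gamma>) (Gamma_graph n (k + 2))" by (simp add: H_def)
  moreover have "U \<subseteq> ?V" by (auto simp: U_def)
  ultimately show ?thesis unfolding k_def using switching_isomorphicI[OF G] by blast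
qed

theorem theorem1:
  fixes \<Gamma> :: "'v sgraph" and n t :: nat
  assumes "t \<ge> 2" and "n \<ge> 6"
    and "index_maximal n t \<Gamma>"
  shows "(t \<le> n - 2 \<longrightarrow> switching_isomorphic \<Gamma> (Gamma_graph n (t + 1))) \<and>
         (t \<ge> n - 1 \<longrightarrow> switching_isomorphic \<Gamma> (Gamma_graph n n))"
proof -
  have main: "switching_isomorphic \<Gamma> (Gamma_graph n (min (t - 1) (n - 2) + 2))"
    using assms by (intro index_maximal_imp_Gamma_graph) auto
  have "min (t - 1) (n - 2) + 2 = t + 1" if "t \<le> n - 2" using that assms by simp
  moreover have "min (t - 1) (n - 2) + 2 = n" if "t \<ge> n - 1" using that assms by simp
  ultimately show ?thesis using main by metis
qed

end
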